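(* If $G$ is a connected claw-free graph of order $n$ with minimum degree $\delta(G) \ge 2$, then $\Psi_g^+(G) \ge \frac{1}{2}n$ and $\Psi_g^-(G) \ge \frac{1}{2}n$.
   Context: All graphs are finite and simple. A graph is claw-free if it has no induced subgraph isomorphic to $K_{1,3}$. For a set $S$ of vertices of a graph $G$, a vertex $v \in S$ is an enclave of $S$ if $N[v] \subseteq S$; $S$ is enclaveless if it contains no enclave. The competition-enclaveless game on $G$ is played by Maximizer and Minimizer, who alternately choose a vertex $v$ not in the set $S$ of previously chosen vertices such that $S \cup \{v\}$ is enclaveless; the game ends when no such vertex exists. Maximizer aims to maximize and Minimizer to minimize the final $|S|$. $\Psi_g^+(G)$ is the final $|S|$ when Maximizer moves first and both play optimally; $\Psi_g^-(G)$ is the same when Minimizer moves first. *)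

theory Defs
  imports Complex_Main "Graph_Theory.Graph_Theory"
begin

text \<open>
  A finite simple graph is a \<^verbatim>\<open>graph\<close> in the sense of the library: a finite
  symmetric digraph without loops and without parallel arcs. Each edge is a pair of
  opposite arcs, so the degree of a vertex is its \<^const>\<open>out_degree\<close>.
\<close>

definition min_degree :: "('a, 'b) pre_digraph \<Rightarrow> nat" where
  "min_degree G = Min (out_degree G ` verts G)"

definition claw_free :: "('a, 'b) pre_digraph \<Rightarrow> bool" where
  "claw_free G \<longleftrightarrow> \<not> (\<exists>H. induced_subgraph H G \<and> K\<^bsub>1,3\<^esub> H)"

definition closed_nbhd :: "('a, 'b) pre_digraph \<Rightarrow> 'a \<Rightarrow> 'a set" where
  "closed_nbhd G v = insert v {u. v \<rightarrow>\<^bsub>G\<^esub> u}"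

definition enclave :: "('a, 'b) pre_digraph \<Rightarrow> 'a set \<Rightarrow> 'a \<Rightarrow> bool" where
  "enclave G S v \<longleftrightarrow> v \<in> S \<and> closed_nbhd G v \<subseteq> S"

definition enclaveless :: "('a, 'b) pre_digraph \<Rightarrow> 'a set \<Rightarrow> bool" where
  "enclaveless G S \<longleftrightarrow> S \<subseteq> verts G \<and> \<not> (\<exists>v. enclave G S v)"

definition legal_moves :: "('a, 'b) pre_digraph \<Rightarrow> 'a set \<Rightarrow> 'a set" where
  "legal_moves G S = {v \<in> verts G - S. enclaveless G (insert v S)}"

datatype player = Maximizer | Minimizer

text \<open>
  Minimax value of the position in which \<^verbatim>\<open>S\<close> has been chosen and the given player
  is to move. The value for infinite vertex sets is irrelevant; that test only makes the
  recursion terminate.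
\<close>

function game_value :: "('a, 'b) pre_digraph \<Rightarrow> player \<Rightarrow> 'a set \<Rightarrow> nat" where
  "game_value G p S =
    (if infinite (verts G) \<or> legal_moves G S = {} then card S
     else case p of
       Maximizer \<Rightarrow> Max ((\<lambda>v. game_value G Minimizer (insert v S)) ` legal_moves G S)
     | Minimizer \<Rightarrow> Min ((\<lambda>v. game_value G Maximizer (insert v S)) ` legal_moves G S))"
  by pat_completeness auto
termination
proof (relation "measure (\<lambda>(G, p, S). card (verts G - S))")
  have dec: "card (verts G - insert v S) < card (verts G - S)"
    if "\<not> (infinite (verts G) \<or> legal_moves G S = {})" "v \<in> legal_moves G S"
    for G :: "('a, 'b) pre_digraph" and S v
    using that by (intro psubset_card_mono) (auto simp: legal_moves_def)
  show "((G, Minimizer, insert v S), G, p, S) \<in> measure (\<lambda>(G, p, S). card (verts G - S))"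
    if "\<not> (infinite (verts G) \<or> legal_moves G S = {})" "v \<in> legal_moves G S"
    for G :: "('a, 'b) pre_digraph" and p S v
    using dec[OF that] by simp
  show "((G, Maximizer, insert v S), G, p, S) \<in> measure (\<lambda>(G, p, S). card (verts G - S))"
    if "\<not> (infinite (verts G) \<or> legal_moves G S = {})" "v \<in> legal_moves G S"
    for G :: "('a, 'b) pre_digraph" and p S v
    using dec[OF that] by simp
qed simp

declare game_value.simps [simp del]

definition Psi_plus :: "('a, 'b) pre_digraph \<Rightarrow> nat" where
  "Psi_plus G = game_value G Maximizer {}"

definition Psi_minus :: "('a, 'b) pre_digraph \<Rightarrow> nat" where
  "Psi_minus G = game_value G Minimizer {}"

end

theory Submission
  imports Defs
begin

text \<open>
  The bound holds for every play, whatever the strategies. When the game ends at \<open>S\<close>, the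
  complement \<open>D\<close> of \<open>S\<close> is a minimal dominating set, so every vertex of \<open>D\<close> either has a private
  neighbour in \<open>S\<close> or is isolated in \<open>D\<close>. Let \<open>A\<close> be the set of vertices of the first kind, \<open>P\<close> a
  set of private neighbours, one for each vertex of \<open>A\<close>, and \<open>I = D - A\<close>. Every vertex of \<open>I\<close> has at
  least two neighbours, all of them in \<open>S - P\<close>, while by claw-freeness a vertex of \<open>S - P\<close> has at
  most two neighbours in the independent set \<open>I\<close>. Hence \<open>card I \<le> card (S - P)\<close>, and therefore
  \<open>card D \<le> card S\<close>.
\<close>

text \<open>Any three vertices of \<open>J\<close> are pairwise non-adjacent neighbours of
  \<open>w\<close>, so with \<open>w\<close> as centre they induce a claw.\<close>

lemma claw_free_card_independent_nbrs_le_2: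
  assumes "graph G" "claw_free G" "J \<subseteq> {v. w \<rightarrow>\<^bsub>G\<^esub> v}"
    and indep: "\<And>u v. u \<in> J \<Longrightarrow> v \<in> J \<Longrightarrow> \<not> u \<rightarrow>\<^bsub>G\<^esub> v"
  shows "card J \<le> 2"
proof (rule ccontr)
  interpret graph G by fact
  assume "\<not> card J \<le> 2"
  then obtain T where T: "T \<subseteq> J" "card T = 3"
    using obtain_subset_with_card_n[of 3 J] by auto
  let ?H = "G \<restriction> insert w T"
  have adj: "w \<rightarrow>\<^bsub>G\<^esub> v" "v \<rightarrow>\<^bsub>G\<^esub> w" if "v \<in> T" for v
    using that T(1) assms(3) graph_symmetric by auto
  have non_adj: "\<not> u \<rightarrow>\<^bsub>G\<^esub> v" if "u \<in> T" "v \<in> T" for u v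
    using that T(1) indep by auto
  obtain t where "t \<in> T"
    using T(2) by fastforce
  then have "insert w T \<subseteq> verts G"
    using adj(1) adj_in_verts by blast
  then have ind: "induced_subgraph ?H G"
    by (rule induced_induce)
  have w_nonadj: "\<not> w \<rightarrow>\<^bsub>G\<^esub> w"
    using adj_not_same by blast
  have "graph ?H"
    using digraphI_induced[OF ind] induced_graph_imp_graph[OF ind]
    by (simp add: graph_def pseudo_graph_def digraph_def)
  moreover have "arcs_ends ?H = {w} \<times> T \<union> T \<times> {w}"
  proof -
    have "arcs_ends ?H = {(x, y). x \<rightarrow>\<^bsub>G\<^esub> y \<and> x \<in> insert w T \<and> y \<in> insert w T}"
      by (auto simp: arcs_ends_def arc_to_ends_def image_iff)
    then show ?thesis
      using adj non_adj w_nonadj by auto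
  qed
  moreover have "verts ?H = {w} \<union> T" "{w} \<inter> T = {}" "card {w} = 1"
    using adj(1) w_nonadj by auto
  ultimately have "K\<^bsub>1,3\<^esub> ?H"
    unfolding complete_bipartite_digraph_def using T(2) by blast
  with ind assms(2) show False
    unfolding claw_free_def by blast
qed

text \<open>\<open>out_degree\<close> counts arcs, not neighbours. Since there are no parallel arcs,
  \<open>head G\<close> is injective on the arcs leaving \<open>v\<close>, so both counts
  agree.\<close>

lemma min_degree_le_card_nbrs:
  assumes "graph G" "v \<in> verts G"
  shows "min_degree G \<le> card {u. v \<rightarrow>\<^bsub>G\<^esub> u}"
proof -
  interpret graph G by fact
  have "{u. v \<rightarrow>\<^bsub>G\<^esub> u} = head G ` out_arcs G v"
    by (auto simp: arcs_ends_def arc_to_ends_def)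
  moreover have "inj_on (head G) (out_arcs G v)"
    by (auto simp: inj_on_def arc_to_ends_def intro!: no_multi_arcs)
  ultimately have "card {u. v \<rightarrow>\<^bsub>G\<^esub> u} = out_degree G v"
    by (simp add: card_image out_degree_def)
  then show ?thesis
    using assms(2) by (simp add: min_degree_def)
qed

lemma card_verts_le_maximal_enclaveless:
  assumes "graph G" "claw_free G" "min_degree G \<ge> 2"
    and S: "enclaveless G S" and maximal: "legal_moves G S = {}"
  shows "card (verts G) \<le> 2 * card S"
proof -
  interpret graph G by fact
  have sym: "v \<rightarrow>\<^bsub>G\<^esub> u" if "u \<rightarrow>\<^bsub>G\<^esub> v" for u v
    using that sym_arcs by (auto simp: symmetric_def dest: symD)
  have SV: "S \<subseteq> verts G"
    using S by (simp add: enclaveless_def)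
  then have finS: "finite S"
    using finite_verts finite_subset by blast
  define D where "D = verts G - S"
  have finD: "finite D" and DV: "D \<subseteq> verts G"
    by (auto simp: D_def)
  define priv where "priv v w \<longleftrightarrow> w \<in> S \<and> {u. w \<rightarrow>\<^bsub>G\<^esub> u} \<inter> D = {v}" for v w
  define A where "A = {v \<in> D. \<exists>w. priv v w}"
  define p where "p v = (SOME w. priv v w)" for v
  define I where "I = D - A"
  have p: "priv v (p v)" if "v \<in> A" for v
    using that unfolding A_def p_def by (auto intro: someI)
  \<comment> \<open>\<open>v\<close> can be recovered from \<open>p v\<close> as its only neighbour
    in \<open>D\<close>.\<close>
  have "inj_on p A"
    using p unfolding inj_on_def priv_def by (metis singleton_inject)
  then have cardP: "card (p ` A) = card A"
    by (rule card_image)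
  have PS: "p ` A \<subseteq> S"
    using p by (auto simp: priv_def)
  have I_nbrs: "u \<in> S - p ` A" if v: "v \<in> I" and vu: "v \<rightarrow>\<^bsub>G\<^esub> u" for u v
  proof -
    have vD: "v \<in> D" "v \<notin> A"
      using v by (auto simp: I_def)
    then have "\<not> enclaveless G (insert v S)"
      using maximal by (auto simp: D_def legal_moves_def)
    then obtain w where w: "w \<in> insert v S" "closed_nbhd G w \<subseteq> insert v S"
      using SV vD(1) DV by (auto simp: enclaveless_def enclave_def)
    \<comment> \<open>An enclave \<open>w\<close> other than \<open>v\<close> would lie in
      \<open>S\<close>. As \<open>S\<close> has no enclave, \<open>v\<close> would be the only
      neighbour of \<open>w\<close> in \<open>D\<close>, which would put \<open>v\<close> in
      \<open>A\<close>. So \<open>v\<close> itself is enclosed.\<close>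
    have "w = v"
    proof (rule ccontr)
      assume "w \<noteq> v"
      then have "w \<in> S" using w by auto
      then have "\<not> closed_nbhd G w \<subseteq> S"
        using S by (auto simp: enclaveless_def enclave_def)
      then have "priv v w"
        using w \<open>w \<in> S\<close> vD(1) by (auto simp: priv_def D_def closed_nbhd_def)
      then show False
        using vD by (auto simp: A_def)
    qed
    then have "u \<in> S"
      using w vu by (auto simp: closed_nbhd_def dest: adj_not_same)
    \<comment> \<open>The only neighbour of \<open>p a\<close> in \<open>D\<close> is
      \<open>a\<close>, while \<open>u\<close> is adjacent to \<open>v\<close>, which lies in
      \<open>D\<close> but not in \<open>A\<close>.\<close>
    moreover have "u \<notin> p ` A"
    proof
      assume "u \<in> p ` A"
      then obtain a where "a \<in> A" "priv a u"
        using p by auto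
      then show False
        using sym[OF vu] vD by (auto simp: priv_def)
    qed
    ultimately show ?thesis by simp
  qed
  let ?Q = "S - p ` A"
  have deg: "2 \<le> card {u \<in> ?Q. v \<rightarrow>\<^bsub>G\<^esub> u}" if "v \<in> I" for v
  proof -
    have "{u \<in> ?Q. v \<rightarrow>\<^bsub>G\<^esub> u} = {u. v \<rightarrow>\<^bsub>G\<^esub> u}"
      using I_nbrs[OF that] by auto
    then show ?thesis
      using min_degree_le_card_nbrs[OF assms(1), of v] assms(3) that DV by (auto simp: I_def)
  qed
  have claw: "card {v \<in> I. v \<rightarrow>\<^bsub>G\<^esub> u} \<le> 2" for u
  proof (rule claw_free_card_independent_nbrs_le_2[OF assms(1,2)])
    show "{v \<in> I. v \<rightarrow>\<^bsub>G\<^esub> u} \<subseteq> {v. u \<rightarrow>\<^bsub>G\<^esub> v}"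
      using sym by auto
    show "\<not> x \<rightarrow>\<^bsub>G\<^esub> y" if "x \<in> {v \<in> I. v \<rightarrow>\<^bsub>G\<^esub> u}" "y \<in> {v \<in> I. v \<rightarrow>\<^bsub>G\<^esub> u}" for x y
      using that I_nbrs[of x y] by (auto simp: I_def D_def)
  qed
  have finI: "finite I"
    using finD by (simp add: I_def)
  \<comment> \<open>Double counting of the edges between \<open>I\<close> and
    \<open>?Q\<close>.\<close>
  have "2 * card I \<le> (\<Sum>v\<in>I. card {u \<in> ?Q. v \<rightarrow>\<^bsub>G\<^esub> u})"
    using sum_bounded_below[of I 2, OF deg] by (simp add: mult.commute)
  also have "\<dots> = (\<Sum>u\<in>?Q. card {v \<in> I. v \<rightarrow>\<^bsub>G\<^esub> u})"
    using finI finS by (intro sum_multicount_gen) auto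
  also have "\<dots> \<le> 2 * card ?Q"
    using sum_bounded_above[of ?Q _ 2, OF claw] by (simp add: mult.commute)
  finally have "card I \<le> card S - card A"
    using PS finS cardP by (simp add: card_Diff_subset finite_subset)
  \<comment> \<open>This ensures that the natural-number difference \<open>card S - card A\<close>
    is not truncated.\<close>
  moreover have "card A \<le> card S"
    using PS finS cardP card_mono by metis
  moreover have "card D = card A + card I"
    using card_Diff_subset[of A D] card_mono[of D A] finD
    by (auto simp: I_def A_def)
  moreover have "card (verts G) = card D + card S"
    using card_Diff_subset[OF finS SV] card_mono[OF finite_verts SV] by (simp add: D_def)
  ultimately show ?thesis by simp
qed

text \<open>Every play from an enclaveless set ends in an enclaveless set without legal moves. A
  bound on all such sets passes up the game tree through \<open>Max\<close> and \<open>Min\<close>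
  alike.\<close>

lemma game_value_ge:
  assumes "finite (verts G)" "enclaveless G S"
    and final: "\<And>T. enclaveless G T \<Longrightarrow> legal_moves G T = {} \<Longrightarrow> k \<le> card T"
  shows "k \<le> game_value G p S"
  using assms
proof (induction G p S rule: game_value.induct)
  case (1 G p S)
  show ?case
  proof (cases "legal_moves G S = {}")
    case True
    then show ?thesis
      using 1 by (simp add: game_value.simps)
  next
    case False
    have fin: "finite (legal_moves G S)"
      using "1.prems"(1) by (auto simp: legal_moves_def)
    have legal: "enclaveless G (insert v S)" if "v \<in> legal_moves G S" for v
      using that by (simp add: legal_moves_def)
    show ?thesis
    proof (cases p)
      case Maximizer
      have "k \<le> game_value G Minimizer (insert v S)" if "v \<in> legal_moves G S" for v
        using "1.IH"(1)[OF _ Maximizer that] False "1.prems" legal[OF that] by blast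
      then show ?thesis
        using False fin "1.prems"(1) Maximizer
        by (subst game_value.simps) (auto simp: Max_ge_iff)
    next
      case Minimizer
      have "k \<le> game_value G Maximizer (insert v S)" if "v \<in> legal_moves G S" for v
        using "1.IH"(2)[OF _ Minimizer that] False "1.prems" legal[OF that] by blast
      then show ?thesis
        using False fin "1.prems"(1) Minimizer
        by (subst game_value.simps) auto
    qed
  qed
qed

theorem theorem5p6:
  fixes G :: "('a, 'b) pre_digraph" and n :: nat
  assumes "graph G"
    and "Digraph_Component.connected G"
    and "claw_free G"
    and "card (verts G) = n"
    and "min_degree G \<ge> 2"
  shows "real (Psi_plus G) \<ge> 1 / 2 * real n \<and> real (Psi_minus G) \<ge> 1 / 2 * real n"
proof -
  interpret graph G by fact
  \<comment> \<open>\<open>game_value_ge\<close> takes a natural number, so n/2 is rounded up;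
    \<open>n div 2\<close> would be too weak for odd \<open>n\<close>.\<close>
  have final: "(n + 1) div 2 \<le> card T" if "enclaveless G T" "legal_moves G T = {}" for T
    using card_verts_le_maximal_enclaveless[OF assms(1,3,5) that] assms(4) by simp
  have "enclaveless G {}"
    by (simp add: enclaveless_def enclave_def)
  then have "(n + 1) div 2 \<le> game_value G q {}" for q
    using final by (intro game_value_ge) auto
  then have "(n + 1) div 2 \<le> Psi_plus G" "(n + 1) div 2 \<le> Psi_minus G"
    unfolding Psi_plus_def Psi_minus_def by blast+
  then have "n \<le> 2 * Psi_plus G" "n \<le> 2 * Psi_minus G"
    by presburger+
  then show ?thesis by linarith
qed

end
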